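(* Let $n\ge 1$ be an integer. For each $j=1,2,\dots,n$ let $\alpha_j\ge 1$ and $0\le \eta_j<1$ be real numbers and let $\beta_j$ be a real number with $$\beta_j\ge \frac{(3-\eta_j)+\sqrt{5\eta_j^2-18\eta_j+17}}{2(1-\eta_j)}.$$ Let $\lambda_1,\dots,\lambda_n,\zeta$ be positive real numbers such that $$\sum_{j=1}^n\frac{1-\eta_j}{\lambda_j}\le \zeta .$$ Then the function $$\mathbb{F}(z)=\left\{\zeta\int_0^z t^{\zeta-1}\prod_{j=1}^n\left(\frac{\mathbb{E}_{\alpha_j,\beta_j}(t)}{t}\right)^{1/\lambda_j}dt\right\}^{1/\zeta},\qquad z\in\mathbb{U},$$ belongs to $\mathcal{S}^*(\delta)$, where $$\delta=\frac{-\left(\sum_{j=1}^n\frac{2(1-\eta_j)}{\lambda_j}-2\zeta+1\right)+\sqrt{\left(\sum_{j=1}^n\frac{2(1-\eta_j)}{\lambda_j}-2\zeta+1\right)^2+8\zeta}}{4\zeta},\qquad 0\le\delta<1.$$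
   Context: $\mathbb{U}=\{z\in\mathbb{C}:|z|<1\}$. $\mathcal{A}$ is the class of functions $f(z)=z+\sum_{k\ge2}a_kz^k$ analytic in $\mathbb{U}$. For $0\le\delta<1$, $\mathcal{S}^*(\delta)$ is the class of $f\in\mathcal{A}$ that are starlike of order $\delta$, i.e. $\mathrm{Re}\left(\frac{zf'(z)}{f(z)}\right)>\delta$ for all $z\in\mathbb{U}$ (the quotient being given its limit value $1$ at $z=0$). For real $\alpha>0$, $\beta>0$, the normalized Mittag-Leffler function is $$\mathbb{E}_{\alpha,\beta}(z)=\Gamma(\beta)\,z\sum_{k=0}^\infty\frac{z^k}{\Gamma(\alpha k+\beta)}=z+\sum_{k=2}^\infty\frac{\Gamma(\beta)}{\Gamma(\alpha(k-1)+\beta)}z^k .$$ The quotient $\mathbb{E}_{\alpha,\beta}(t)/t$ takes the value $1$ at $t=0$. All many-valued functions are taken with their principal branch, so that $\mathbb{F}\in\mathcal{A}$. Explicitly, $\mathbb{F}(z)=z\,h(z)^{1/\zeta}$ with $$h(z)=\zeta\int_0^1 s^{\zeta-1}\prod_{j=1}^n\left(\frac{\mathbb{E}_{\alpha_j,\beta_j}(sz)}{sz}\right)^{1/\lambda_j}ds,\qquad h(0)=1,$$ where the powers with exponent $1/\lambda_j$ are principal powers, and $h^{1/\zeta}$ is the analytic branch on $\mathbb{U}$ with value $1$ at $z=0$ (that $h$ has no zeros in $\mathbb{U}$, so that this branch exists, is understood as part of the assertion $\mathbb{F}\in\mathcal{S}^*(\delta)$). *)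

theory Defs
  imports "HOL-Complex_Analysis.Complex_Analysis"
begin

abbreviation unit_disc :: "complex set" where
  "unit_disc \<equiv> ball 0 1"

definition class_A :: "(complex \<Rightarrow> complex) set" where
  "class_A = {f. f holomorphic_on unit_disc \<and>
     (\<exists>a. a 0 = 0 \<and> a 1 = 1 \<and> (\<forall>z\<in>unit_disc. (\<lambda>k. a k * z ^ k) sums f z))}"

text \<open>The quotient \<open>z f'(z) / f(z)\<close> has the limit value 1 at the origin. It is required to be
  a genuine quotient elsewhere, so zeros of \<open>f\<close> other than the origin are excluded explicitly.\<close>

definition starlike_of_order :: "real \<Rightarrow> (complex \<Rightarrow> complex) set" where
  "starlike_of_order \<delta> = {f \<in> class_A. \<forall>z\<in>unit_disc.
     (z \<noteq> 0 \<longrightarrow> f z \<noteq> 0) \<and> Re (if z = 0 then 1 else z * deriv f z / f z) > \<delta>}"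

definition mittag_leffler_norm :: "real \<Rightarrow> real \<Rightarrow> complex \<Rightarrow> complex" where
  "mittag_leffler_norm \<alpha> \<beta> z =
     of_real (Gamma \<beta>) * z * (\<Sum>k. z ^ k / of_real (Gamma (\<alpha> * real k + \<beta>)))"

definition mittag_leffler_quot :: "real \<Rightarrow> real \<Rightarrow> complex \<Rightarrow> complex" where
  "mittag_leffler_quot \<alpha> \<beta> t = (if t = 0 then 1 else mittag_leffler_norm \<alpha> \<beta> t / t)"

text \<open>The substitution \<open>t = s z\<close> turns
  \<open>\<zeta> \<integral>\<^sub>0\<^sup>z t powr (\<zeta> - 1) * (\<Prod>j. (E\<^sub>j(t) / t) powr (1 / lam\<^sub>j)) dt\<close> into
  \<open>z powr \<zeta> * operator_h z\<close>. Complex \<open>powr\<close> is the principal power.\<close>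

definition operator_h ::
  "nat \<Rightarrow> (nat \<Rightarrow> real) \<Rightarrow> (nat \<Rightarrow> real) \<Rightarrow> (nat \<Rightarrow> real) \<Rightarrow> real \<Rightarrow> complex \<Rightarrow> complex" where
  "operator_h n \<alpha> \<beta> lam \<zeta> z = of_real \<zeta> *
     integral {0..1} (\<lambda>s::real. of_real (s powr (\<zeta> - 1)) *
       (\<Prod>j=1..n. mittag_leffler_quot (\<alpha> j) (\<beta> j) (of_real s * z) powr of_real (1 / lam j)))"

definition log_branch :: "(complex \<Rightarrow> complex) \<Rightarrow> (complex \<Rightarrow> complex) \<Rightarrow> bool" where
  "log_branch h L \<longleftrightarrow> L holomorphic_on unit_disc \<and> L 0 = 0 \<and> (\<forall>z\<in>unit_disc. exp (L z) = h z)"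

text \<open>The analytic branch of \<open>h\<^sup>c\<close> on the unit disc with value 1 at the origin, for \<open>h\<close> with
  \<open>h 0 = 1\<close>. It need not be the pointwise principal power, since \<open>h\<close> may take negative real
  values. By the two lemmas below it is well defined on the disc whenever \<open>h\<close> is holomorphic
  and zero-free there.\<close>

definition powr_branch :: "(complex \<Rightarrow> complex) \<Rightarrow> real \<Rightarrow> complex \<Rightarrow> complex" where
  "powr_branch h c z = exp (of_real c * (SOME L. log_branch h L) z)"

lemma log_branch_exists:
  assumes "h holomorphic_on unit_disc" "\<And>z. z \<in> unit_disc \<Longrightarrow> h z \<noteq> 0" "h 0 = 1"
  shows "\<exists>L. log_branch h L"
proof -
  obtain g where g: "g holomorphic_on unit_disc" "\<And>z. z \<in> unit_disc \<Longrightarrow> h z = exp (g z)"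
    using contractible_imp_holomorphic_log[OF assms(1) convex_imp_contractible[OF convex_ball] assms(2)]
    by blast
  have "exp (g 0) = 1" using g(2)[of 0] assms(3) by simp
  then have "log_branch h (\<lambda>z. g z - g 0)"
    using g by (auto simp: log_branch_def exp_diff intro!: holomorphic_intros)
  then show ?thesis by blast
qed

lemma log_branch_unique:
  assumes L: "log_branch h L" and M: "log_branch h M" and z: "z \<in> unit_disc"
  shows "L z = M z"
proof -
  have e: "exp (L w) = exp (M w)" if "w \<in> unit_disc" for w
    using L M that by (simp add: log_branch_def)
  have d: "((\<lambda>w. L w - M w) has_field_derivative 0) (at w within unit_disc)"
    if w: "w \<in> unit_disc" for w
  proof -
    obtain D where D: "(L has_field_derivative D) (at w)"
      using L w unfolding log_branch_def by (meson holomorphic_on_open open_ball)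
    obtain E where E: "(M has_field_derivative E) (at w)"
      using M w unfolding log_branch_def by (meson holomorphic_on_open open_ball)
    have "((\<lambda>w. exp (L w)) has_field_derivative exp (M w) * E) (at w)"
      by (rule has_field_derivative_transform_within_open[OF DERIV_chain2[OF DERIV_exp E] open_ball w])
        (simp add: e)
    then have "exp (L w) * D = exp (M w) * E"
      by (rule DERIV_unique[OF DERIV_chain2[OF DERIV_exp D]])
    then have "D = E" using e[OF w] by simp
    then have "((\<lambda>w. L w - M w) has_field_derivative 0) (at w)"
      using DERIV_diff[OF D E] by simp
    then show ?thesis by (rule has_field_derivative_at_within)
  qed
  obtain c where c: "\<And>w. w \<in> unit_disc \<Longrightarrow> L w - M w = c"
    using has_field_derivative_zero_constant[OF convex_ball d] by blast
  from c[OF z] c[of 0] show ?thesis using L M by (simp add: log_branch_def)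
qed

definition operator_F ::
  "nat \<Rightarrow> (nat \<Rightarrow> real) \<Rightarrow> (nat \<Rightarrow> real) \<Rightarrow> (nat \<Rightarrow> real) \<Rightarrow> real \<Rightarrow> complex \<Rightarrow> complex" where
  "operator_F n \<alpha> \<beta> lam \<zeta> z = z * powr_branch (operator_h n \<alpha> \<beta> lam \<zeta>) (1 / \<zeta>) z"

end

theory Submission
  imports Defs
begin

text \<open>The bound on \<open>\<beta>\<^sub>j\<close> gives more than starlikeness of order \<open>\<eta>\<^sub>j\<close>: with \<open>e\<^sub>j(z) = E\<^sub>j(z) / z\<close>,
  comparing the coefficients with a geometric series yields
  \<open>\<bar>z e\<^sub>j' / e\<^sub>j\<bar> \<le> 3/4 (1 - \<eta>\<^sub>j)\<close>. Hence the product \<open>P = exp W\<close> of the powers of the \<open>e\<^sub>j\<close> satisfies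
  \<open>\<bar>z W'\<bar> \<le> 3/4 A\<close> with \<open>A = \<Sum>\<^sub>j (1 - \<eta>\<^sub>j) / \<lambda>\<^sub>j \<le> \<zeta>\<close>.
  The function \<open>h\<close> solves \<open>\<zeta> h + z h' = \<zeta> P\<close>, so \<open>q = z F' / F = 1 + z h' / (\<zeta> h) = P / h\<close> solves the
  Briot-Bouquet equation \<open>\<zeta> (q - 1) + z q' / q = z W'\<close>. If \<open>\<bar>q - 1\<bar>\<close> first reaches the value
  \<open>u = 1 - \<delta>\<close> at \<open>z\<^sub>0\<close>, then \<open>z\<^sub>0 q'(z\<^sub>0) = m (q(z\<^sub>0) - 1)\<close> with a real \<open>m \<ge> 1\<close> by Jack's lemma, so
  \<open>\<bar>z\<^sub>0 W'(z\<^sub>0)\<bar> \<ge> u (\<zeta> + 1 / (1 + u))\<close>, which exceeds \<open>3/4 A\<close>.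
  The factor \<open>3/4\<close> matters: for \<open>P = (1 - z) powr (- 2 \<zeta>)\<close> with \<open>\<zeta> = A > 1\<close>, where only
  \<open>Re (z P' / P) > - A\<close>, the infimum of \<open>Re q\<close> is 0.\<close>

section \<open>Real estimates for the order \<delta> and the parameter bound on \<beta>\<close>

text \<open>\<open>\<delta>\<close> is the positive root of
  \<open>2 * \<zeta> * x^2 + b * x - 1\<close> with \<open>b = 2 * A - 2 * \<zeta> + 1\<close>. This
  polynomial is negative at 0 and equals \<open>2 * A\<close> at 1, which places the root strictly
  between. The third claim is the margin needed to keep \<open>q\<close> in the disc of radius
  \<open>1 - \<delta>\<close> about 1.\<close>

lemma starlike_order_estimates:
  fixes A \<zeta> \<delta> :: real
  assumes "0 < A" "A \<le> \<zeta>"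
    and \<delta>: "\<delta> = (- (2 * A - 2 * \<zeta> + 1) + sqrt ((2 * A - 2 * \<zeta> + 1)\<^sup>2 + 8 * \<zeta>)) / (4 * \<zeta>)"
  shows "0 < \<delta>" "\<delta> < 1" "3 / 4 * A < (1 - \<delta>) * (\<zeta> + 1 / (1 + (1 - \<delta>)))"
proof -
  define b where "b = 2 * A - 2 * \<zeta> + 1"
  define r where "r = sqrt (b\<^sup>2 + 8 * \<zeta>)"
  have \<zeta>: "0 < \<zeta>" using assms by linarith
  have r2: "r\<^sup>2 = b\<^sup>2 + 8 * \<zeta>" unfolding r_def using \<zeta> by simp
  have \<delta>r: "\<delta> = (- b + r) / (4 * \<zeta>)" by (simp add: \<delta> b_def r_def)
  have "\<bar>b\<bar> < r" unfolding r_def using \<zeta> real_sqrt_less_mono[of "b\<^sup>2" "b\<^sup>2 + 8 * \<zeta>"] by simp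
  then show pos: "0 < \<delta>" using \<zeta> by (simp add: \<delta>r)
  have "r < 4 * \<zeta> + b"
    unfolding r_def
  proof (rule real_less_lsqrt)
    show "0 \<le> 4 * \<zeta> + b" using assms \<zeta> by (simp add: b_def)
    have "(4 * \<zeta> + b)\<^sup>2 - (b\<^sup>2 + 8 * \<zeta>) = 16 * A * \<zeta>"
      by (simp add: b_def algebra_simps power2_eq_square)
    then show "b\<^sup>2 + 8 * \<zeta> < (4 * \<zeta> + b)\<^sup>2" using assms \<zeta> by (smt (verit) mult_pos_pos)
  qed
  then show less1: "\<delta> < 1" using \<zeta> by (simp add: \<delta>r)
  have "4 * \<zeta> * \<delta> = r - b" using \<zeta> by (simp add: \<delta>r)
  then have "(4 * \<zeta> * \<delta> + b)\<^sup>2 = b\<^sup>2 + 8 * \<zeta>" using r2 by simp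
  then have "8 * \<zeta> * (2 * \<zeta> * \<delta>\<^sup>2 + b * \<delta> - 1) = 0"
    by (simp add: algebra_simps power2_eq_square)
  then have quad: "2 * \<zeta> * \<delta>\<^sup>2 + b * \<delta> = 1" using \<zeta> by simp
  \<comment> \<open>With this value of \<open>A\<close> and the lower bound for \<open>\<zeta>\<close> that \<open>A \<le> \<zeta>\<close> entails, the last claim
    reduces to the positivity of \<open>12 \<delta>\<^sup>2 - 9 \<delta> + 2\<close>.\<close>
  have A: "A = (1 - \<delta>) * (\<zeta> + 1 / (2 * \<delta>))"
    using quad pos by (simp add: b_def field_simps power2_eq_square)
  have \<zeta>ge: "1 - \<delta> \<le> 2 * \<delta>\<^sup>2 * \<zeta>"
  proof -
    have "A * \<delta> \<le> \<zeta> * \<delta>" using \<open>A \<le> \<zeta>\<close> pos by simp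
    then show ?thesis using quad by (simp add: b_def algebra_simps)
  qed
  have "0 < 12 * (\<delta> - 3 / 8)\<^sup>2 + 5 / 16"
    by (smt (verit) zero_le_power2 divide_pos_pos)
  also have "\<dots> = (1 - 4 * \<delta>) * (2 - \<delta>) + 8 * \<delta>\<^sup>2"
    by (simp add: algebra_simps power2_eq_square)
  \<comment> \<open>Here \<open>1 - 4 * \<delta>\<close> is read as
    \<open>(1 - \<delta>) - 3 * \<delta>\<close>, so that \<open>\<zeta>ge\<close> applies to the
    first term.\<close>
  also have "\<dots> \<le> (2 * \<delta>\<^sup>2 * \<zeta> - 3 * \<delta>) * (2 - \<delta>) + 8 * \<delta>\<^sup>2"
    using \<zeta>ge less1 by (intro add_right_mono mult_right_mono) auto
  also have "\<dots> = 8 * \<delta>\<^sup>2 * (2 - \<delta>) * (\<zeta> / 4 - 3 / (8 * \<delta>) + 1 / (2 - \<delta>))"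
    using pos less1 by (simp add: field_simps power2_eq_square)
  finally have "0 < \<zeta> / 4 - 3 / (8 * \<delta>) + 1 / (2 - \<delta>)"
    using pos less1 by (elim zero_less_mult_pos) simp
  then have "3 / 4 * (\<zeta> + 1 / (2 * \<delta>)) < \<zeta> + 1 / (2 - \<delta>)"
    by (simp add: field_simps)
  then have "(1 - \<delta>) * (3 / 4 * (\<zeta> + 1 / (2 * \<delta>))) < (1 - \<delta>) * (\<zeta> + 1 / (2 - \<delta>))"
    using less1 by simp
  then show "3 / 4 * A < (1 - \<delta>) * (\<zeta> + 1 / (1 + (1 - \<delta>)))"
    by (simp add: A mult.left_commute)
qed

text \<open>The assumed bound is the larger root of
  \<open>(1 - \<eta>) * (x^2 - x - 1) = 2 * x + 1\<close>, whose discriminant is the radicand.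
  Beyond that root the left side dominates, and the factor 3/4 comes from comparing
  \<open>(\<beta> + 1)^2\<close> with \<open>\<beta> * (2 * \<beta> + 1)\<close>.\<close>

lemma parameter_bound_estimates:
  fixes \<beta> \<eta> :: real
  assumes \<eta>: "0 \<le> \<eta>" "\<eta> < 1"
    and \<beta>: "\<beta> \<ge> ((3 - \<eta>) + sqrt (5 * \<eta>\<^sup>2 - 18 * \<eta> + 17)) / (2 * (1 - \<eta>))"
  shows "3 < \<beta>" "(\<beta> + 1)\<^sup>2 / (\<beta> * (\<beta>\<^sup>2 - \<beta> - 1)) \<le> 3 / 4 * (1 - \<eta>)"
proof -
  define D where "D = 5 * \<eta>\<^sup>2 - 18 * \<eta> + 17"
  have D: "D = (3 - \<eta>)\<^sup>2 + 4 * (1 - \<eta>) * (2 - \<eta>)"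
    by (simp add: D_def algebra_simps power2_eq_square)
  then have Dge: "(3 - \<eta>)\<^sup>2 < D" using \<eta> by simp
  have D0: "0 \<le> D" using less_imp_le[OF le_less_trans[OF zero_le_power2 Dge]] .
  have s: "3 - \<eta> < sqrt D" using Dge by (rule real_less_rsqrt)
  have le: "sqrt D \<le> 2 * (1 - \<eta>) * \<beta> - (3 - \<eta>)"
    using \<beta> \<eta> by (simp add: D_def field_simps)
  have "D = (sqrt D)\<^sup>2" using D0 by simp
  also have "\<dots> \<le> (2 * (1 - \<eta>) * \<beta> - (3 - \<eta>))\<^sup>2"
    using le D0 by (intro power_mono) auto
  finally have "0 \<le> 4 * (1 - \<eta>) * ((1 - \<eta>) * (\<beta>\<^sup>2 - \<beta> - 1) - (2 * \<beta> + 1))"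
    unfolding D by (simp add: algebra_simps power2_eq_square)
  then have key: "2 * \<beta> + 1 \<le> (1 - \<eta>) * (\<beta>\<^sup>2 - \<beta> - 1)"
    using \<eta> by (simp add: zero_le_mult_iff)
  have "(3 - \<eta>) < (1 - \<eta>) * \<beta>" using le s by linarith
  moreover have "(1 - \<eta>) * 3 \<le> 3 - \<eta>" using \<eta> by simp
  ultimately have "(1 - \<eta>) * 3 < (1 - \<eta>) * \<beta>" by linarith
  then show b3: "3 < \<beta>" using \<eta> by (simp only: mult_less_cancel_left)
  have "3 * \<beta> < \<beta>\<^sup>2" using b3 by (simp add: power2_eq_square)
  then have pos: "0 < \<beta>\<^sup>2 - \<beta> - 1" using b3 by linarith
  \<comment> \<open>The next inequality amounts to
    \<open>2 * \<beta>^2 - 5 * \<beta> - 4 \<ge> 0\<close>, for which \<open>3 < \<beta>\<close> is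
    too weak. Dropping the factor \<open>1 - \<eta>\<close> from \<open>key\<close> gives
    \<open>\<beta>^2 \<ge> 3 * \<beta> + 2\<close>, which suffices.\<close>
  have "(1 - \<eta>) * (\<beta>\<^sup>2 - \<beta> - 1) \<le> \<beta>\<^sup>2 - \<beta> - 1"
    using \<eta> pos by (intro mult_left_le_one_le) auto
  then have "(\<beta> + 1)\<^sup>2 \<le> 3 / 4 * \<beta> * (2 * \<beta> + 1)"
    using key b3 by (simp add: algebra_simps power2_eq_square)
  also have "\<dots> \<le> 3 / 4 * \<beta> * ((1 - \<eta>) * (\<beta>\<^sup>2 - \<beta> - 1))"
    using key b3 by (intro mult_left_mono) auto
  also have "\<dots> = 3 / 4 * (1 - \<eta>) * (\<beta> * (\<beta>\<^sup>2 - \<beta> - 1))" by (simp only: mult_ac)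
  finally show "(\<beta> + 1)\<^sup>2 / (\<beta> * (\<beta>\<^sup>2 - \<beta> - 1)) \<le> 3 / 4 * (1 - \<eta>)"
    using b3 pos by (subst pos_divide_le_eq) auto
qed

section \<open>Jack's lemma and the inversion of a circle\<close>

text \<open>Rescaling by \<open>z0\<close> and \<open>\<psi> z0\<close> gives a self-map of the unit
  disc that fixes 0 and takes the value 1 at 1; \<open>m\<close> is its derivative at 1, controlled
  by the Schwarz lemma. On the circle itself only differentiability at \<open>z0\<close> enters,
  which suits a quotient whose denominator is known to be nonzero only inside and at
  \<open>z0\<close>.\<close>

lemma Jack_lemma:
  fixes z0 :: complex
  assumes hol: "\<psi> holomorphic_on ball 0 (norm z0)" and "\<psi> 0 = 0"
    and der: "(\<psi> has_field_derivative D) (at z0)" and z0: "z0 \<noteq> 0" "\<psi> z0 \<noteq> 0"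
    and less: "\<And>z. norm z < norm z0 \<Longrightarrow> norm (\<psi> z) < norm (\<psi> z0)"
  obtains m :: real where "1 \<le> m" "z0 * D = of_real m * \<psi> z0"
proof -
  define f where "f = (\<lambda>w. \<psi> (z0 * w) / \<psi> z0)"
  have scale: "norm (z0 * w) < norm z0" if "norm w < 1" for w
    using that z0(1) by (simp add: norm_mult)
  have holf: "f holomorphic_on ball 0 1"
    unfolding f_def using z0(2)
    by (intro holomorphic_intros holomorphic_on_compose_gen[OF _ hol, unfolded o_def])
       (auto dest!: scale)
  have schwarz: "norm (f w) \<le> norm w" if "norm w < 1" for w
    using holf that less[OF scale] z0(2) \<open>\<psi> 0 = 0\<close>
    by (intro Schwarz_Lemma(1)[of f]) (auto simp: f_def norm_divide)
  define M where "M = z0 * D / \<psi> z0"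
  have derf: "(f has_field_derivative M) (at 1)"
    unfolding f_def M_def using z0(2) der
    by (auto intro!: derivative_eq_intros DERIV_chain2[of \<psi>])
  \<comment> \<open>By Schwarz, \<open>f (exp \<tau>) * exp (- \<tau>)\<close> has modulus at most 1 for \<open>Re \<tau> < 0\<close>, and it equals 1 at
    \<open>\<tau> = 0\<close>, so its derivative \<open>M - 1\<close> there must be real and nonnegative.\<close>
  have dir: "Re ((M - 1) * \<omega>) \<le> 0" if \<omega>: "Re \<omega> < 0" for \<omega>
  proof (rule ccontr)
    define G where "G = (\<lambda>\<tau>. f (exp (\<tau> * \<omega>)) * exp (- \<tau> * \<omega>))"
    define g where "g = (\<lambda>t::real. Re (G (of_real t)))"
    have f1: "f 1 = 1" using z0(2) by (simp add: f_def)
    have "((\<lambda>\<tau>. exp (\<tau> * \<omega>)) has_field_derivative \<omega>) (at 0)"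
      by (auto intro!: derivative_eq_intros)
    then have "((\<lambda>\<tau>. f (exp (\<tau> * \<omega>))) has_field_derivative M * \<omega>) (at 0)"
      using derf by (intro DERIV_chain2[of f]) auto
    moreover have "((\<lambda>\<tau>. exp (- \<tau> * \<omega>)) has_field_derivative - \<omega>) (at 0)"
      by (auto intro!: derivative_eq_intros)
    ultimately have "(G has_field_derivative (M - 1) * \<omega>) (at 0)"
      unfolding G_def using DERIV_mult f1 by (fastforce simp: algebra_simps)
    then have "(g has_real_derivative Re ((M - 1) * \<omega>)) (at 0)"
      unfolding g_def has_real_derivative_iff_has_vector_derivative
      by (intro bounded_linear.has_vector_derivative[OF bounded_linear_Re]
          has_vector_derivative_real_field) simp
    moreover assume "\<not> Re ((M - 1) * \<omega>) \<le> 0"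
    ultimately obtain d where d: "d > 0" "\<And>h. 0 < h \<Longrightarrow> h < d \<Longrightarrow> g 0 < g h"
      using has_real_derivative_pos_inc_right[of g "Re ((M - 1) * \<omega>)" 0 UNIV] by auto
    define t where "t = d / 2"
    have t: "0 < t" "t < d" using d by (auto simp: t_def)
    have "norm (exp (of_real t * \<omega>)) < 1" using \<omega> t by (simp add: mult_pos_neg)
    note schwarz[OF this]
    then have "norm (G t) \<le> norm (exp (of_real t * \<omega>)) * norm (exp (- of_real t * \<omega>))"
      unfolding norm_mult G_def by (intro mult_right_mono) auto
    also have "\<dots> = 1" by (simp flip: norm_mult exp_add)
    finally have "g t \<le> 1"
      unfolding g_def by (rule order_trans[OF complex_Re_le_cmod])
    moreover have "g 0 = 1" using f1 by (simp add: g_def G_def)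
    ultimately show False using d(2)[OF t] by simp
  qed
  \<comment> \<open>The two nearly vertical directions \<open>-e + i\<close> and
    \<open>-e - i\<close> bound both signs of \<open>Im M\<close>. Letting \<open>e\<close> tend to
    0 kills \<open>Im M\<close>, and \<open>e = 1\<close> gives \<open>Re M \<ge> 1\<close>.\<close>
  have le: "\<bar>Im M\<bar> \<le> e * (Re M - 1)" if "e > 0" for e :: real
    using dir[of "Complex (-e) 1"] dir[of "Complex (-e) (-1)"] that
    by (simp add: algebra_simps)
  have "((\<lambda>e. e * (Re M - 1)) \<longlongrightarrow> 0 * (Re M - 1)) (at_right 0)"
    by (intro tendsto_intros)
  then have "\<bar>Im M\<bar> \<le> 0 * (Re M - 1)"
    by (rule tendsto_lowerbound) (auto simp: le eventually_at_filter)
  then have "Im M = 0" by simp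
  moreover have "1 \<le> Re M" using le[of 1] by simp
  ultimately have "M = of_real (Re M)" by (simp add: complex_eq_iff)
  then show ?thesis using that[of "Re M"] \<open>1 \<le> Re M\<close> z0(2) by (simp add: M_def field_simps)
qed

text \<open>Inversion sends the circle of radius \<open>u\<close> about 1 to the circle with
  diameter from \<open>1 / (1 + u)\<close> to \<open>1 / (1 - u)\<close> on the real axis; its
  leftmost point is the image of \<open>1 + u\<close>.\<close>

lemma Re_inverse_ge:
  assumes "norm (q - 1 :: complex) = u" "u < 1"
  shows "1 / (1 + u) \<le> Re (1 / q)"
proof -
  have "0 \<le> u" using assms by auto
  have "q \<noteq> 0" using assms by auto
  have "(Re q - 1)\<^sup>2 + (Im q)\<^sup>2 = u\<^sup>2"
    using cmod_power2[of "q - 1"] assms by simp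
  then have n: "(Re q)\<^sup>2 + (Im q)\<^sup>2 = u\<^sup>2 - 1 + 2 * Re q"
    by (simp add: power2_eq_square algebra_simps)
  have "Re q - 1 \<le> u" using complex_Re_le_cmod[of "q - 1"] assms by simp
  then have "(1 - u) * (Re q - 1 - u) \<le> 0" using assms by (simp add: mult_nonneg_nonpos)
  then have "(Re q)\<^sup>2 + (Im q)\<^sup>2 \<le> (1 + u) * Re q"
    unfolding n by (simp add: power2_eq_square algebra_simps)
  moreover have "0 < (Re q)\<^sup>2 + (Im q)\<^sup>2"
    using \<open>q \<noteq> 0\<close> by (simp add: complex_eq_iff sum_power2_gt_zero_iff)
  ultimately show ?thesis using \<open>0 \<le> u\<close> by (simp add: Re_divide field_simps)
qed

section \<open>Power series of the Mittag-Leffler quotient\<close>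

text \<open>For \<open>\<alpha> = 1\<close> the denominator is \<open>Gamma \<beta>\<close> times
  the product of \<open>\<beta>, \<beta> + 1, ..., \<beta> + k\<close>, and every factor after the
  first is at least \<open>\<beta> + 1\<close>. Larger \<open>\<alpha>\<close> only increases it,
  because Gamma is increasing from 3/2 on. The index starts at \<open>Suc k\<close> since the
  constant coefficient is 1.\<close>

lemma Gamma_quot_le:
  fixes \<alpha> \<beta> :: real
  assumes "1 \<le> \<alpha>" "3 / 2 \<le> \<beta>"
  shows "Gamma \<beta> / Gamma (\<alpha> * real (Suc k) + \<beta>) \<le> (1 / (\<beta> + 1)) ^ k / \<beta>"
proof -
  have "Gamma \<beta> * (\<beta> * (\<beta> + 1) ^ k) \<le> Gamma (\<beta> + real (Suc k))"
  proof (induction k)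
    case 0
    have "\<beta> \<notin> \<int>\<^sub>\<le>\<^sub>0" using assms by (auto elim!: nonpos_Ints_cases)
    then show ?case by (simp add: Gamma_plus1 mult.commute)
  next
    case (Suc k)
    have "Gamma \<beta> * (\<beta> * (\<beta> + 1) ^ Suc k) = (\<beta> + 1) * (Gamma \<beta> * (\<beta> * (\<beta> + 1) ^ k))"
      by simp
    also have "\<dots> \<le> (\<beta> + real (Suc k)) * Gamma (\<beta> + real (Suc k))"
      using Suc assms by (intro mult_mono) auto
    also have "\<dots> = Gamma (\<beta> + real (Suc k) + 1)"
      using assms by (intro Gamma_plus1[symmetric]) (auto elim!: nonpos_Ints_cases)
    finally show ?case by (simp add: add_ac)
  qed
  also have "\<dots> \<le> Gamma (\<alpha> * real (Suc k) + \<beta>)"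
  proof (cases "\<beta> + real (Suc k) = \<alpha> * real (Suc k) + \<beta>")
    case False
    moreover have "1 * real (Suc k) \<le> \<alpha> * real (Suc k)"
      using assms by (intro mult_right_mono) auto
    ultimately have "\<beta> + real (Suc k) < \<alpha> * real (Suc k) + \<beta>"
      unfolding mult_1_left by linarith
    then show ?thesis
      using assms by (intro less_imp_le Gamma_real_strict_mono) auto
  qed (simp only: order_refl)
  finally have "Gamma \<beta> * (\<beta> * (\<beta> + 1) ^ k) \<le> Gamma (\<alpha> * real (Suc k) + \<beta>)" .
  moreover have "0 < Gamma (\<alpha> * real (Suc k) + \<beta>)"
    using assms by (intro Gamma_real_pos add_nonneg_pos) auto
  ultimately show ?thesis using assms by (simp add: divide_simps mult_ac)
qed

lemma mittag_leffler_quot_sums: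
  assumes "1 \<le> \<alpha>" "3 / 2 \<le> \<beta>" "norm z < 1"
  shows "(\<lambda>k. of_real (Gamma \<beta> / Gamma (\<alpha> * real k + \<beta>)) * z ^ k) sums mittag_leffler_quot \<alpha> \<beta> z"
proof -
  define c where "c = (\<lambda>k. Gamma \<beta> / Gamma (\<alpha> * real k + \<beta>))"
  have \<beta>: "Gamma \<beta> > 0" using assms by simp
  have nonneg: "0 \<le> c k" for k
  proof -
    have "0 < Gamma (\<alpha> * real k + \<beta>)"
      using assms by (intro Gamma_real_pos add_nonneg_pos) auto
    then show ?thesis using \<beta> by (simp add: c_def)
  qed
  have "summable (\<lambda>k. of_real (c k) * z ^ k)"
  proof (rule summable_comparison_test')
    have "norm (c (Suc k)) \<le> (1 / (\<beta> + 1)) ^ k / \<beta>" for k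
      using nonneg[of "Suc k"] Gamma_quot_le[OF assms(1,2), of k] by (simp add: c_def)
    then have "summable (\<lambda>k. c (Suc k))"
      using assms by (intro summable_comparison_test'[OF summable_divide[OF summable_geometric]]) auto
    then show "summable c" by (simp add: summable_Suc_iff)
    show "norm (of_real (c k) * z ^ k) \<le> c k" for k
      using nonneg[of k] assms
      by (auto simp: norm_mult norm_power intro!: mult_left_le power_le_one)
  qed
  moreover have "(\<Sum>k. of_real (c k) * z ^ k) = mittag_leffler_quot \<alpha> \<beta> z"
  proof (cases "z = 0")
    case True
    then show ?thesis using \<beta> powser_zero[of "\<lambda>k. complex_of_real (c k)"]
      by (simp add: mittag_leffler_quot_def c_def)
  next
    case False
    have "(\<lambda>k. of_real (c k) * z ^ k)
        = (\<lambda>k. of_real (Gamma \<beta>) * (z ^ k / of_real (Gamma (\<alpha> * real k + \<beta>))))"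
      by (simp add: c_def)
    moreover from this have "summable (\<lambda>k. z ^ k / of_real (Gamma (\<alpha> * real k + \<beta>)))"
      using \<open>summable (\<lambda>k. of_real (c k) * z ^ k)\<close> \<beta> by (simp only: summable_cmult_iff) auto
    ultimately show ?thesis
      using False suminf_mult[of "\<lambda>k. z ^ k / of_real (Gamma (\<alpha> * real k + \<beta>))" "of_real (Gamma \<beta>)"]
      by (simp add: mittag_leffler_quot_def mittag_leffler_norm_def)
  qed
  ultimately show ?thesis by (simp add: sums_iff c_def)
qed

lemma holomorphic_mittag_leffler_quot:
  assumes "1 \<le> \<alpha>" "3 / 2 \<le> \<beta>"
  shows "mittag_leffler_quot \<alpha> \<beta> holomorphic_on ball 0 1"
  using mittag_leffler_quot_sums[OF assms]
  by (intro power_series_holomorphic[where a = "\<lambda>k. of_real (Gamma \<beta> / Gamma (\<alpha> * real k + \<beta>))"]) auto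

text \<open>With \<open>r = 1 / (\<beta> + 1)\<close>, the series without its constant term is
  dominated by the sum of \<open>r ^ k / \<beta>\<close>, and the derivative by the sum of
  \<open>(k + 1) * r ^ k / \<beta>\<close>. Their values are the two bounds, uniform on the
  disc.\<close>

lemma mittag_leffler_quot_bounds:
  assumes "1 \<le> \<alpha>" "3 < \<beta>" "norm z < 1"
  shows "norm (mittag_leffler_quot \<alpha> \<beta> z - 1) \<le> (\<beta> + 1) / \<beta>\<^sup>2"
    and "norm (deriv (mittag_leffler_quot \<alpha> \<beta>) z) \<le> (\<beta> + 1)\<^sup>2 / \<beta> ^ 3"
proof -
  define c where "c = (\<lambda>k. Gamma \<beta> / Gamma (\<alpha> * real k + \<beta>))"
  define r where "r = 1 / (\<beta> + 1)"
  have \<beta>: "Gamma \<beta> > 0" using assms by simp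
  have r: "norm r < 1" "1 - r = \<beta> / (\<beta> + 1)" using assms by (auto simp: r_def field_simps)
  have sums: "(\<lambda>k. of_real (c k) * w ^ k) sums mittag_leffler_quot \<alpha> \<beta> w" if "norm w < 1" for w
    unfolding c_def using mittag_leffler_quot_sums assms that by simp
  have "0 \<le> c k" for k
  proof -
    have "0 < Gamma (\<alpha> * real k + \<beta>)"
      using assms by (intro Gamma_real_pos add_nonneg_pos) auto
    then show ?thesis using \<beta> by (simp add: c_def)
  qed
  \<comment> \<open>The exponent is independent of the index because \<open>c (Suc k)\<close> meets
    \<open>z ^ Suc k\<close> in the series and \<open>z ^ k\<close> in its derivative.\<close>
  then have "norm (of_real (c k) * z ^ j) \<le> c k" for j k
    using assms by (auto simp: norm_mult norm_power intro!: mult_left_le power_le_one)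
  also have "c (Suc k) \<le> r ^ k / \<beta>" for k
    using Gamma_quot_le[of \<alpha> \<beta> k] assms unfolding c_def r_def by simp
  finally have c: "norm (of_real (c (Suc k)) * z ^ j) \<le> r ^ k / \<beta>" for j k .
  have "(\<lambda>k. of_real (c (Suc k)) * z ^ Suc k) sums (mittag_leffler_quot \<alpha> \<beta> z - 1)"
    using sums[OF assms(3)] \<beta> by (subst sums_Suc_iff) (simp add: c_def)
  moreover have "(\<lambda>k. r ^ k / \<beta>) sums (1 / (1 - r) / \<beta>)"
    using r by (intro sums_divide geometric_sums)
  ultimately have "norm (mittag_leffler_quot \<alpha> \<beta> z - 1) \<le> 1 / (1 - r) / \<beta>"
    using c by (rule norm_sums_le)
  also have "\<dots> = (\<beta> + 1) / \<beta>\<^sup>2" unfolding r by (simp add: power2_eq_square)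
  finally show "norm (mittag_leffler_quot \<alpha> \<beta> z - 1) \<le> (\<beta> + 1) / \<beta>\<^sup>2" .
  have "(mittag_leffler_quot \<alpha> \<beta> has_field_derivative deriv (mittag_leffler_quot \<alpha> \<beta>) z) (at z)"
    using holomorphic_mittag_leffler_quot[of \<alpha> \<beta>] assms
    by (intro holomorphic_derivI[of _ "ball 0 1"]) auto
  then have "(\<lambda>k. diffs (\<lambda>k. of_real (c k)) k * z ^ k) sums deriv (mittag_leffler_quot \<alpha> \<beta>) z"
    using sums assms(3) by (intro termdiffs_sums_strong[where K = 1]) auto
  moreover have "(\<lambda>k. real (Suc k) * r ^ k / \<beta>) sums (1 / (1 - r)\<^sup>2 / \<beta>)"
    using geometric_deriv_sums[OF r(1)] by (intro sums_divide) simp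
  moreover have "norm (diffs (\<lambda>k. of_real (c k)) k * z ^ k) \<le> real (Suc k) * r ^ k / \<beta>" for k
  proof -
    have "norm (diffs (\<lambda>k. of_real (c k)) k * z ^ k)
        = real (Suc k) * norm (of_real (c (Suc k)) * z ^ k)"
      by (simp only: diffs_def norm_mult norm_of_nat mult.assoc)
    also have "\<dots> \<le> real (Suc k) * (r ^ k / \<beta>)" using c by (intro mult_left_mono) auto
    finally show ?thesis by simp
  qed
  ultimately have "norm (deriv (mittag_leffler_quot \<alpha> \<beta>) z) \<le> 1 / (1 - r)\<^sup>2 / \<beta>"
    by (rule norm_sums_le)
  also have "\<dots> = (\<beta> + 1)\<^sup>2 / \<beta> ^ 3" unfolding r by (simp add: power2_eq_square power3_eq_cube)
  finally show "norm (deriv (mittag_leffler_quot \<alpha> \<beta>) z) \<le> (\<beta> + 1)\<^sup>2 / \<beta> ^ 3" .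
qed

section \<open>The integral operator and its Briot-Bouquet equation\<close>

lemma beta_integral_operator:
  fixes P :: "complex \<Rightarrow> complex" and \<zeta> :: real
  assumes "0 < \<zeta>" and P: "P holomorphic_on ball 0 1"
    and h: "\<And>z. norm z < 1 \<Longrightarrow> h z = of_real \<zeta> *
      integral {0..1} (\<lambda>s::real. of_real (s powr (\<zeta> - 1)) * P (of_real s * z))"
  shows "h holomorphic_on ball 0 1"
    and "norm z < 1 \<Longrightarrow> of_real \<zeta> * h z + z * deriv h z = of_real \<zeta> * P z"
proof -
  \<comment> \<open>Integrate the power series termwise; FTC for \<open>s powr \<zeta> * H (s * z)\<close> then identifies the
    resulting series \<open>H\<close> with \<open>h\<close>.\<close>
  define a where "a = (\<lambda>k. (deriv ^^ k) P 0 / fact k)"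
  \<comment> \<open>The factor is \<open>\<zeta>\<close> times the integral of
    \<open>s powr (\<zeta> - 1) * s ^ k\<close> over the unit interval. Conversely,
    \<open>\<zeta> * H + z * H'\<close> multiplies the k-th coefficient by
    \<open>\<zeta> + k\<close>, which restores \<open>\<zeta> * P\<close>.\<close>
  define b where "b = (\<lambda>k. of_real (\<zeta> / (\<zeta> + real k)) * a k)"
  define H where "H = (\<lambda>z. \<Sum>k. b k * z ^ k)"
  have a: "(\<lambda>k. a k * z ^ k) sums P z" if "norm z < 1" for z
    using holomorphic_power_series[OF P, of z] that by (simp add: a_def)
  have b: "(\<lambda>k. b k * z ^ k) sums H z" if "norm z < 1" for z
    unfolding H_def
  proof (rule summable_sums, rule summable_comparison_test')
    show "summable (\<lambda>k. norm (a k * z ^ k))"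
    proof -
      obtain K where K: "norm z < K" "K < 1" using dense[OF \<open>norm z < 1\<close>] by blast
      then have "0 \<le> K" by (intro order_trans[OF norm_ge_zero less_imp_le])
      then have *: "norm (of_real K :: complex) = K" by simp
      show ?thesis
        by (rule powser_insidea[OF sums_summable[OF a, of "of_real K"]]) (simp_all only: * K)
    qed
    show "norm (b k * z ^ k) \<le> norm (a k * z ^ k)" for k
    proof -
      have "norm (complex_of_real (\<zeta> / (\<zeta> + real k))) \<le> 1"
        using \<open>0 < \<zeta>\<close> unfolding norm_of_real by simp
      then show ?thesis
        unfolding b_def norm_mult by (intro mult_right_mono mult_left_le_one_le) auto
    qed
  qed
  have holH: "H holomorphic_on ball 0 1"
    using b by (intro power_series_holomorphic[where a = b]) auto
  have derH: "(H has_field_derivative deriv H z) (at z)" if "norm z < 1" for z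
    using holH that by (intro holomorphic_derivI[of _ "ball 0 1"]) auto
  have ode: "of_real \<zeta> * H z + z * deriv H z = of_real \<zeta> * P z" if "norm z < 1" for z
  proof -
    have "(\<lambda>k. diffs b k * z ^ k) sums deriv H z"
      using b derH that by (intro termdiffs_sums_strong[where K = 1]) auto
    from sums_mult[OF this, of z] have "(\<lambda>k. of_nat (Suc k) * b (Suc k) * z ^ Suc k) sums (z * deriv H z)"
      by (simp add: diffs_def mult_ac)
    then have "(\<lambda>k. of_nat k * b k * z ^ k) sums (z * deriv H z)"
      by (subst (asm) sums_Suc_iff) simp
    with sums_mult[OF b[OF that], of "of_real \<zeta>"]
    have "(\<lambda>k. of_real \<zeta> * (b k * z ^ k) + of_nat k * b k * z ^ k) sums
        (of_real \<zeta> * H z + z * deriv H z)"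
      by (rule sums_add)
    moreover have "of_real \<zeta> * (b k * z ^ k) + of_nat k * b k * z ^ k = of_real \<zeta> * (a k * z ^ k)" for k
    proof -
      have "of_real \<zeta> * b k + of_nat k * b k = of_real ((\<zeta> + real k) * (\<zeta> / (\<zeta> + real k))) * a k"
        by (simp only: b_def of_real_mult of_real_add of_real_of_nat_eq distrib_right mult.assoc)
      also have "(\<zeta> + real k) * (\<zeta> / (\<zeta> + real k)) = \<zeta>" using \<open>0 < \<zeta>\<close> by simp
      finally show ?thesis by (metis distrib_right mult.assoc)
    qed
    ultimately show ?thesis using sums_mult[OF a[OF that], of "of_real \<zeta>"] by (simp add: sums_iff)
  qed
  have eq: "h z = H z" if z: "norm z < 1" for z
  proof -
    have sz: "norm (of_real s * z) < 1" if "0 \<le> s" "s \<le> 1" for s :: real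
    proof -
      have "norm (of_real s * z) \<le> norm z"
        using that by (simp add: norm_mult mult_left_le_one_le)
      then show ?thesis using z by linarith
    qed
    \<comment> \<open>For \<open>\<zeta> < 1\<close> the weight is unbounded near 0, so
      differentiability is asked for in the open interval only. The antiderivative is continuous up
      to 0 and vanishes there.\<close>
    have "((\<lambda>s::real. of_real \<zeta> * (of_real (s powr (\<zeta> - 1)) * P (of_real s * z))) has_integral
       of_real (1 powr \<zeta>) * H (of_real 1 * z) - of_real (0 powr \<zeta>) * H (of_real 0 * z)) {0..1}"
    proof (rule fundamental_theorem_of_calculus_interior)
      show "continuous_on {0..1} (\<lambda>s::real. of_real (s powr \<zeta>) * H (of_real s * z))"
        using \<open>0 < \<zeta>\<close> sz
        by (intro continuous_intros continuous_on_powr'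
            continuous_on_compose2[OF holomorphic_on_imp_continuous_on[OF holH]]) auto
      fix s :: real assume s: "s \<in> {0<..<1}"
      have "((\<lambda>s. s powr \<zeta>) has_real_derivative \<zeta> * s powr (\<zeta> - 1)) (at s)"
        using s by (auto intro!: derivative_eq_intros)
      then have 1: "((\<lambda>s. complex_of_real (s powr \<zeta>)) has_vector_derivative of_real (\<zeta> * s powr (\<zeta> - 1))) (at s)"
        by (intro has_vector_derivative_of_real) (simp add: has_real_derivative_iff_has_vector_derivative)
      have "((\<lambda>w. H (w * z)) has_field_derivative deriv H (of_real s * z) * z) (at (of_real s))"
        using s derH[OF sz, of s] by (auto intro!: derivative_eq_intros DERIV_chain2[of H])
      then have 2: "((\<lambda>s. H (of_real s * z)) has_vector_derivative deriv H (of_real s * z) * z) (at s)"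
        by (rule has_vector_derivative_real_field)
      have pw: "complex_of_real (s powr \<zeta>) = of_real (s powr (\<zeta> - 1)) * of_real s"
      proof -
        have "s powr \<zeta> = s powr (\<zeta> - 1) * s" using s by (simp add: powr_diff)
        then show ?thesis by (simp only: of_real_mult)
      qed
      have "of_real (s powr \<zeta>) * (deriv H (of_real s * z) * z) + of_real (\<zeta> * s powr (\<zeta> - 1)) * H (of_real s * z)
         = of_real (s powr (\<zeta> - 1)) * (of_real \<zeta> * H (of_real s * z) + of_real s * z * deriv H (of_real s * z))"
        unfolding pw by (simp add: algebra_simps)
      also have "\<dots> = of_real \<zeta> * (of_real (s powr (\<zeta> - 1)) * P (of_real s * z))"
        using s ode[OF sz, of s] by simp
      finally show "((\<lambda>s. of_real (s powr \<zeta>) * H (of_real s * z)) has_vector_derivative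
          of_real \<zeta> * (of_real (s powr (\<zeta> - 1)) * P (of_real s * z))) (at s)"
        using has_vector_derivative_mult[OF 1 2] by simp
    qed simp
    from integral_unique[OF this] show ?thesis by (simp add: h[OF z])
  qed
  then show "h holomorphic_on ball 0 1"
    using holH by (subst holomorphic_cong[OF refl, of _ h H]) auto
  show "of_real \<zeta> * h z + z * deriv h z = of_real \<zeta> * P z" if z: "norm z < 1"
  proof -
    have "eventually (\<lambda>w. w \<in> ball 0 1) (nhds z)"
      using z by (intro eventually_nhds_in_open) auto
    then have "eventually (\<lambda>w. h w = H w) (nhds z)"
      by eventually_elim (simp add: eq)
    then have "deriv h z = deriv H z" by (rule deriv_cong_ev) simp
    then show ?thesis using ode eq z by simp
  qed
qed

text \<open>The bound \<open>norm (q - 1) < u\<close> for \<open>q = exp W / h\<close> is stated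
  with the denominator cleared: the strict inequality then also yields
  \<open>h z \<noteq> 0\<close>, and no division by \<open>h\<close> is presupposed.\<close>

lemma briot_bouquet_disc:
  fixes h W :: "complex \<Rightarrow> complex" and \<zeta> u :: real
  assumes "0 < \<zeta>" "0 < u" "u < 1"
    and W: "W holomorphic_on ball 0 1" "W 0 = 0"
    and h: "h holomorphic_on ball 0 1"
    and ode: "\<And>z. norm z < 1 \<Longrightarrow> of_real \<zeta> * h z + z * deriv h z = of_real \<zeta> * exp (W z)"
    and bound: "\<And>z. norm z < 1 \<Longrightarrow> norm (z * deriv W z) < u * (\<zeta> + 1 / (1 + u))"
    and "norm z < 1"
  shows "norm (exp (W z) - h z) < u * norm (h z)"
proof (rule ccontr)
  assume z: "\<not> norm (exp (W z) - h z) < u * norm (h z)"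
  \<comment> \<open>\<open>d\<close> is continuous even at possible zeros of \<open>h\<close>, so a
    failure point \<open>z0\<close> of least modulus exists by compactness.\<close>
  define d where "d = (\<lambda>z. norm (exp (W z) - h z) - u * norm (h z))"
  have contd: "continuous_on (ball 0 1) d"
    unfolding d_def using W h
    by (intro continuous_intros holomorphic_on_imp_continuous_on)
  define S where "S = {w \<in> cball 0 (norm z). d w \<in> {0..}}"
  have sub: "cball 0 (norm z) \<subseteq> ball (0::complex) 1" using \<open>norm z < 1\<close> by auto
  have "compact S"
    unfolding S_def compact_eq_bounded_closed
    using continuous_closed_preimage[OF continuous_on_subset[OF contd sub] closed_cball, of "{0..}"]
    by (auto simp: vimage_def Int_def intro: bounded_subset[OF bounded_cball[of 0 "norm z"]])
  moreover have "z \<in> S" using z by (simp add: S_def d_def)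
  ultimately obtain z0 where z0S: "z0 \<in> S" and z0min: "\<And>w. w \<in> S \<Longrightarrow> norm z0 \<le> norm w"
    using continuous_attains_inf[of S norm] by (auto intro: continuous_intros)
  have z01: "norm z0 < 1" using z0S \<open>norm z < 1\<close> by (auto simp: S_def)
  have neg: "d w < 0" if "norm w < norm z0" for w
    using z0min[of w] that z0S by (force simp: S_def)
  have h0: "h 0 = 1" using ode[of 0] W \<open>0 < \<zeta>\<close> by simp
  have "z0 \<noteq> 0" using z0S h0 W(2) \<open>0 < u\<close> by (auto simp: S_def d_def)
  have cl: "closure (ball (0::complex) (norm z0)) = cball 0 (norm z0)"
    using \<open>z0 \<noteq> 0\<close> by (simp add: closure_ball)
  have "d z0 \<le> 0"
  proof (rule continuous_le_on_closure[of "ball (0::complex) (norm z0)"])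
    show "continuous_on (closure (ball (0::complex) (norm z0))) d"
      unfolding cl using z01 by (intro continuous_on_subset[OF contd]) auto
  qed (use \<open>z0 \<noteq> 0\<close> neg in \<open>auto simp: cl less_imp_le\<close>)
  then have eq: "norm (exp (W z0) - h z0) = u * norm (h z0)" using z0S by (auto simp: S_def d_def)
  \<comment> \<open>If \<open>h z0\<close> were 0, the equality would force
    \<open>exp (W z0) = 0\<close>.\<close>
  have nz0: "h z0 \<noteq> 0" using eq by auto
  have nz: "h w \<noteq> 0" if "norm w < norm z0" for w
    using neg[OF that] by (auto simp: d_def)
  define \<psi> where "\<psi> = (\<lambda>w. exp (W w) / h w - 1)"
  have norm\<psi>: "norm (\<psi> w) = norm (exp (W w) - h w) / norm (h w)" if "h w \<noteq> 0" for w
    using that by (simp add: \<psi>_def flip: norm_divide) (simp add: field_simps)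
  define q where "q = exp (W z0) / h z0"
  have q: "norm (q - 1) = u" using norm\<psi>[OF nz0] eq nz0 by (simp add: q_def \<psi>_def)
  have "q \<noteq> 0" using nz0 by (simp add: q_def)
  define D where "D = (deriv W z0 * exp (W z0) * h z0 - exp (W z0) * deriv h z0) / (h z0 * h z0)"
  have derW: "(W has_field_derivative deriv W z0) (at z0)"
    and derh: "(h has_field_derivative deriv h z0) (at z0)"
    using W h z01 by (auto intro!: holomorphic_derivI[of _ "ball 0 1"])
  obtain m where m: "1 \<le> m" "z0 * D = of_real m * \<psi> z0"
  proof (rule Jack_lemma[of \<psi> z0 D])
    show "\<psi> holomorphic_on ball 0 (norm z0)"
      unfolding \<psi>_def using nz z01
      by (intro holomorphic_intros holomorphic_on_subset[OF W(1)] holomorphic_on_subset[OF h]) auto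
    show "(\<psi> has_field_derivative D) (at z0)"
      unfolding \<psi>_def D_def using nz0 derW derh
      by (auto intro!: derivative_eq_intros simp: mult_ac)
    show "\<psi> z0 \<noteq> 0" using q \<open>0 < u\<close> by (auto simp: q_def \<psi>_def)
    show "norm (\<psi> w) < norm (\<psi> z0)" if "norm w < norm z0" for w
      using neg[OF that] nz[OF that] norm\<psi>[of w] norm\<psi>[OF nz0] eq nz0
      by (simp add: d_def pos_divide_less_eq)
  qed (use \<open>z0 \<noteq> 0\<close> h0 W in \<open>auto simp: \<psi>_def\<close>)
  have zh: "z0 * deriv h z0 = of_real \<zeta> * (exp (W z0) - h z0)"
    using ode[OF z01] by (simp add: algebra_simps)
  \<comment> \<open>\<open>D\<close> is the derivative of \<open>exp W / h\<close> at
    \<open>z0\<close>. Substituting the differential equation for \<open>h\<close> and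
    \<open>z0 * D = m * (q - 1)\<close> expresses \<open>z0 * deriv W z0\<close> through
    \<open>q\<close> and \<open>m\<close> alone.\<close>
  have "z0 * D = q * (z0 * deriv W z0) - q * (z0 * deriv h z0) / h z0"
    unfolding D_def q_def using nz0 by (simp add: field_simps)
  also have "\<dots> = q * (z0 * deriv W z0 - of_real \<zeta> * (q - 1))"
    unfolding zh q_def using nz0 by (simp add: field_simps)
  finally have "q * (z0 * deriv W z0 - of_real \<zeta> * (q - 1)) = of_real m * (q - 1)"
    using m by (simp add: \<psi>_def q_def)
  then have "z0 * deriv W z0 = (q - 1) * (of_real \<zeta> + of_real m * (1 / q))"
    using \<open>q \<noteq> 0\<close> by (simp add: field_simps)
  then have "norm (z0 * deriv W z0) = u * norm (of_real \<zeta> + of_real m * (1 / q))"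
    by (simp add: norm_mult q)
  also have "\<dots> \<ge> u * (\<zeta> + 1 / (1 + u))"
  proof -
    have "1 * (1 / (1 + u)) \<le> m * Re (1 / q)"
      using Re_inverse_ge[OF q] m \<open>0 < u\<close> \<open>u < 1\<close> by (intro mult_mono) auto
    then have "\<zeta> + 1 / (1 + u) \<le> Re (of_real \<zeta> + of_real m * (1 / q))"
      by (simp add: times_complex.sel del: times_divide_eq_right mult_1_right)
    also have "\<dots> \<le> norm (of_real \<zeta> + of_real m * (1 / q))" by (rule complex_Re_le_cmod)
    finally show ?thesis using \<open>0 < u\<close> by simp
  qed
  finally show False using bound[OF z01] by simp
qed

section \<open>Logarithmic derivatives and the starlikeness criterion\<close>

text \<open>The quotient lies within \<open>(\<beta> + 1) / \<beta>^2 < 1\<close> of 1. This gives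
  the positive real part and the lower bound \<open>(\<beta>^2 - \<beta> - 1) / \<beta>^2\<close>
  for its modulus, by which the bound on the derivative is divided.\<close>

lemma mittag_leffler_quot_log_deriv:
  fixes \<alpha> \<beta> \<eta> :: real
  assumes "1 \<le> \<alpha>" "0 \<le> \<eta>" "\<eta> < 1"
    and "\<beta> \<ge> ((3 - \<eta>) + sqrt (5 * \<eta>\<^sup>2 - 18 * \<eta> + 17)) / (2 * (1 - \<eta>))"
    and z: "norm z < 1"
  shows "0 < Re (mittag_leffler_quot \<alpha> \<beta> z)"
    and "norm (z * deriv (mittag_leffler_quot \<alpha> \<beta>) z / mittag_leffler_quot \<alpha> \<beta> z) \<le> 3 / 4 * (1 - \<eta>)"
proof -
  let ?e = "mittag_leffler_quot \<alpha> \<beta>"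
  have \<beta>: "3 < \<beta>" "(\<beta> + 1)\<^sup>2 / (\<beta> * (\<beta>\<^sup>2 - \<beta> - 1)) \<le> 3 / 4 * (1 - \<eta>)"
    using parameter_bound_estimates assms by blast+
  note e = mittag_leffler_quot_bounds[OF assms(1) \<beta>(1) z]
  have "3 * \<beta> < \<beta>\<^sup>2" using \<beta>(1) by (simp add: power2_eq_square)
  then have pos: "0 < \<beta>\<^sup>2 - \<beta> - 1" using \<beta>(1) by linarith
  then have lt: "(\<beta> + 1) / \<beta>\<^sup>2 < 1" using \<beta>(1) by simp
  have "- Re (?e z - 1) \<le> norm (?e z - 1)"
    using abs_Re_le_cmod[of "?e z - 1"] by linarith
  then show "0 < Re (?e z)" using e(1) lt by simp
  have "norm (1::complex) \<le> norm (?e z) + norm (?e z - 1)"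
    using norm_triangle_ineq4[of "?e z" "?e z - 1"] by simp
  then have low: "1 - (\<beta> + 1) / \<beta>\<^sup>2 \<le> norm (?e z)" using e(1) by simp
  have "norm z * norm (deriv ?e z) \<le> (\<beta> + 1)\<^sup>2 / \<beta> ^ 3"
    using e(2) z by (intro order_trans[OF mult_left_le_one_le]) auto
  then have "norm (z * deriv ?e z / ?e z) \<le> ((\<beta> + 1)\<^sup>2 / \<beta> ^ 3) / (1 - (\<beta> + 1) / \<beta>\<^sup>2)"
    unfolding norm_mult norm_divide using low lt \<beta>(1) by (intro frac_le) auto
  also have "\<dots> = (\<beta> + 1)\<^sup>2 / (\<beta> * (\<beta>\<^sup>2 - \<beta> - 1))"
  proof -
    have "1 - (\<beta> + 1) / \<beta>\<^sup>2 = (\<beta>\<^sup>2 - \<beta> - 1) / \<beta>\<^sup>2" using \<beta>(1) by (simp add: field_simps)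
    then show ?thesis using \<beta>(1) by (simp add: power2_eq_square power3_eq_cube)
  qed
  finally show "norm (z * deriv ?e z / ?e z) \<le> 3 / 4 * (1 - \<eta>)" using \<beta>(2) by (rule order_trans)
qed

text \<open>Logarithmic differentiation of \<open>F = z * exp (L / \<zeta>)\<close> with
  \<open>L' = h' / h\<close> gives \<open>z * F' / F = 1 + z * h' / (\<zeta> * h)\<close>; at the
  origin the prescribed value 1 exceeds \<open>\<delta>\<close>.\<close>

lemma mult_exp_log_branch_starlike:
  assumes "0 < \<zeta>" "\<delta> < 1" and h: "h holomorphic_on unit_disc" "h 0 = 1"
    and nz: "\<And>z. z \<in> unit_disc \<Longrightarrow> h z \<noteq> 0"
    and re: "\<And>z. z \<in> unit_disc \<Longrightarrow> \<delta> < Re (1 + z * deriv h z / (of_real \<zeta> * h z))"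
  shows "(\<lambda>z. z * powr_branch h (1 / \<zeta>) z) \<in> starlike_of_order \<delta>"
proof -
  define L where "L = (SOME L. log_branch h L)"
  define F where "F = (\<lambda>z. z * exp (of_real (1 / \<zeta>) * L z))"
  have "log_branch h L"
    unfolding L_def using log_branch_exists[OF h(1) nz h(2)] by (rule someI_ex)
  then have L: "L holomorphic_on unit_disc" "L 0 = 0" "\<And>z. z \<in> unit_disc \<Longrightarrow> exp (L z) = h z"
    by (auto simp: log_branch_def)
  have derL: "(L has_field_derivative deriv h z / h z) (at z)" if z: "z \<in> unit_disc" for z
  proof -
    have dL: "(L has_field_derivative deriv L z) (at z)"
      by (rule holomorphic_derivI[OF L(1) open_ball z])
    have "(h has_field_derivative exp (L z) * deriv L z) (at z)"
      by (rule has_field_derivative_transform_within_open[OF DERIV_chain2[OF DERIV_exp dL] open_ball z])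
        (simp add: L(3))
    then have "deriv h z = h z * deriv L z" using L(3)[OF z] by (simp add: DERIV_imp_deriv)
    then show ?thesis using dL nz[OF z] by simp
  qed
  have derF: "deriv F z = exp (of_real (1 / \<zeta>) * L z) * (1 + z * deriv h z / (of_real \<zeta> * h z))"
    if z: "z \<in> unit_disc" for z
    unfolding F_def
    by (rule DERIV_imp_deriv) (use nz[OF z] \<open>0 < \<zeta>\<close> in
      \<open>auto intro!: derivative_eq_intros derL[OF z] simp: field_simps\<close>)
  have F: "F holomorphic_on unit_disc"
    unfolding F_def using L by (intro holomorphic_intros)
  have "F \<in> class_A"
    unfolding class_A_def
  proof (intro CollectI conjI exI ballI)
    show "(\<lambda>k. (deriv ^^ k) F 0 / fact k * z ^ k) sums F z" if "z \<in> unit_disc" for z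
      using holomorphic_power_series[OF F that] by simp
    show "(deriv ^^ 0) F 0 / fact 0 = 0" by (simp add: F_def)
    show "(deriv ^^ 1) F 0 / fact 1 = 1" using derF[of 0] L(2) by simp
  qed (rule F)
  moreover have "z * deriv F z / F z = 1 + z * deriv h z / (of_real \<zeta> * h z)"
    if "z \<in> unit_disc" "z \<noteq> 0" for z
    unfolding derF[OF that(1)] using that by (simp add: F_def)
  ultimately have "F \<in> starlike_of_order \<delta>"
    using re \<open>\<delta> < 1\<close> unfolding starlike_of_order_def by (auto simp: F_def)
  then show ?thesis by (simp add: F_def powr_branch_def L_def)
qed

theorem theorem2p1:
  fixes n :: nat and \<alpha> \<beta> \<eta> lam :: "nat \<Rightarrow> real" and \<zeta> \<delta> :: real
  assumes "n \<ge> 1"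
    and "\<And>j. j \<in> {1..n} \<Longrightarrow> \<alpha> j \<ge> 1"
    and "\<And>j. j \<in> {1..n} \<Longrightarrow> 0 \<le> \<eta> j \<and> \<eta> j < 1"
    and "\<And>j. j \<in> {1..n} \<Longrightarrow>
      \<beta> j \<ge> ((3 - \<eta> j) + sqrt (5 * (\<eta> j)\<^sup>2 - 18 * \<eta> j + 17)) / (2 * (1 - \<eta> j))"
    and "\<And>j. j \<in> {1..n} \<Longrightarrow> lam j > 0"
    and "\<zeta> > 0"
    and "(\<Sum>j=1..n. (1 - \<eta> j) / lam j) \<le> \<zeta>"
    and "\<delta> = (- ((\<Sum>j=1..n. 2 * (1 - \<eta> j) / lam j) - 2 * \<zeta> + 1)
      + sqrt (((\<Sum>j=1..n. 2 * (1 - \<eta> j) / lam j) - 2 * \<zeta> + 1)\<^sup>2 + 8 * \<zeta>)) / (4 * \<zeta>)"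
  shows "0 \<le> \<delta> \<and> \<delta> < 1
    \<and> (\<forall>z\<in>unit_disc. operator_h n \<alpha> \<beta> lam \<zeta> z \<noteq> 0)
    \<and> (\<exists>L. log_branch (operator_h n \<alpha> \<beta> lam \<zeta>) L)
    \<and> operator_F n \<alpha> \<beta> lam \<zeta> \<in> starlike_of_order \<delta>"
proof -
  note \<alpha> = assms(2) and \<eta> = assms(3) and \<beta> = assms(4) and lam = assms(5) and \<zeta> = assms(6)
  define A where "A = (\<Sum>j=1..n. (1 - \<eta> j) / lam j)"
  define e where "e = (\<lambda>j. mittag_leffler_quot (\<alpha> j) (\<beta> j))"
  \<comment> \<open>Each \<open>e j\<close> maps the disc into the right half-plane, so the
    principal logarithms are holomorphic and \<open>exp W\<close> is exactly the product of
    principal powers.\<close>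
  define W where "W = (\<lambda>z. \<Sum>j=1..n. of_real (1 / lam j) * Ln (e j z))"
  define h where "h = operator_h n \<alpha> \<beta> lam \<zeta>"
  have "0 < A"
    unfolding A_def using \<open>n \<ge> 1\<close> \<eta> lam by (intro sum_pos) auto
  moreover have "A \<le> \<zeta>" using assms(7) by (simp add: A_def)
  moreover have "(\<Sum>j=1..n. 2 * (1 - \<eta> j) / lam j) = 2 * A"
    by (simp add: A_def sum_distrib_left)
  ultimately have \<delta>: "0 < \<delta>" "\<delta> < 1" "3 / 4 * A < (1 - \<delta>) * (\<zeta> + 1 / (1 + (1 - \<delta>)))"
    using starlike_order_estimates[of A \<zeta> \<delta>] assms(8) by auto
  have e: "0 < Re (e j z)" "norm (z * deriv (e j) z / e j z) \<le> 3 / 4 * (1 - \<eta> j)"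
    if "j \<in> {1..n}" "norm z < 1" for j z
    using mittag_leffler_quot_log_deriv[OF \<alpha> _ _ \<beta>, of j j z] \<eta>[of j] that by (auto simp: e_def)
  have notneg: "e j z \<notin> \<real>\<^sub>\<le>\<^sub>0" if "j \<in> {1..n}" "norm z < 1" for j z
    using e(1)[OF that] by (auto simp: complex_nonpos_Reals_iff)
  have hole: "e j holomorphic_on ball 0 1" if "j \<in> {1..n}" for j
    unfolding e_def using parameter_bound_estimates(1)[of "\<eta> j" "\<beta> j"] \<alpha> \<eta> \<beta> that
    by (intro holomorphic_mittag_leffler_quot) force+
  have W: "W holomorphic_on ball 0 1"
    unfolding W_def using hole notneg by (intro holomorphic_intros) auto
  have W0: "W 0 = 0" by (simp add: W_def e_def mittag_leffler_quot_def)
  have derW: "norm (z * deriv W z) \<le> 3 / 4 * A" if z: "norm z < 1" for z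
  proof -
    have "(W has_field_derivative (\<Sum>j=1..n. of_real (1 / lam j) * (deriv (e j) z / e j z))) (at z)"
      unfolding W_def
    proof (intro DERIV_sum DERIV_cmult)
      fix j assume j: "j \<in> {1..n}"
      have "(e j has_field_derivative deriv (e j) z) (at z)"
        using hole[OF j] z by (intro holomorphic_derivI[of _ "ball 0 1"]) auto
      from DERIV_chain2[of Ln, OF has_field_derivative_Ln[OF notneg[OF j z]] this]
      show "((\<lambda>z. Ln (e j z)) has_field_derivative deriv (e j) z / e j z) (at z)"
        by (simp add: field_simps)
    qed
    then have "z * deriv W z = (\<Sum>j=1..n. of_real (1 / lam j) * (z * deriv (e j) z / e j z))"
      by (simp add: DERIV_imp_deriv sum_distrib_left mult_ac)
    also have "norm \<dots> \<le> (\<Sum>j=1..n. 1 / lam j * (3 / 4 * (1 - \<eta> j)))"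
    proof (rule sum_norm_le)
      fix j assume j: "j \<in> {1..n}"
      have "norm (of_real (1 / lam j) * (z * deriv (e j) z / e j z))
          = 1 / lam j * norm (z * deriv (e j) z / e j z)"
        using lam[OF j] by (simp only: norm_mult norm_of_real) simp
      also have "\<dots> \<le> 1 / lam j * (3 / 4 * (1 - \<eta> j))"
        using e(2)[OF j z] lam[OF j] by (intro mult_left_mono) auto
      finally show "norm (of_real (1 / lam j) * (z * deriv (e j) z / e j z))
          \<le> 1 / lam j * (3 / 4 * (1 - \<eta> j))" .
    qed
    also have "\<dots> = 3 / 4 * A" unfolding A_def sum_distrib_left by (intro sum.cong) auto
    finally show ?thesis .
  qed
  have P: "(\<Prod>j=1..n. e j z powr of_real (1 / lam j)) = exp (W z)" if z: "norm z < 1" for z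
  proof -
    have "(\<Prod>j=1..n. e j z powr of_real (1 / lam j)) = (\<Prod>j=1..n. exp (of_real (1 / lam j) * Ln (e j z)))"
    proof (rule prod.cong[OF refl])
      fix j assume "j \<in> {1..n}"
      then have "e j z \<noteq> 0" using e(1)[of j z] z by auto
      then show "e j z powr of_real (1 / lam j) = exp (of_real (1 / lam j) * Ln (e j z))"
        by (simp add: powr_def)
    qed
    then show ?thesis by (simp add: W_def exp_sum)
  qed
  have heq: "h z = of_real \<zeta> *
      integral {0..1} (\<lambda>s::real. of_real (s powr (\<zeta> - 1)) * exp (W (of_real s * z)))"
    if z: "norm z < 1" for z
    unfolding h_def operator_h_def
  proof (intro arg_cong2[where f = "(*)"] refl integral_cong)
    fix s :: real assume "s \<in> {0..1}"
    then have "norm (of_real s * z) \<le> norm z"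
      by (simp add: norm_mult mult_left_le_one_le)
    then have "norm (of_real s * z) < 1" using z by linarith
    from P[OF this] show "(\<Prod>j=1..n. mittag_leffler_quot (\<alpha> j) (\<beta> j) (of_real s * z) powr of_real (1 / lam j))
        = exp (W (of_real s * z))" by (simp add: e_def)
  qed
  have expW: "(\<lambda>z. exp (W z)) holomorphic_on ball 0 1" using W by (intro holomorphic_intros)
  note hol = beta_integral_operator(1)[OF \<zeta> expW heq]
    and ode = beta_integral_operator(2)[OF \<zeta> expW heq]
  \<comment> \<open>The radius \<open>u = 1 - \<delta>\<close> is admissible because
    \<open>0 < \<delta> < 1\<close> holds strictly.\<close>
  have disc: "norm (exp (W z) - h z) < (1 - \<delta>) * norm (h z)" if z: "norm z < 1" for z
  proof (rule briot_bouquet_disc[OF \<zeta> _ _ W W0 hol ode _ z])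
    show "norm (w * deriv W w) < (1 - \<delta>) * (\<zeta> + 1 / (1 + (1 - \<delta>)))" if "norm w < 1" for w
      using derW[OF that] \<delta>(3) by linarith
  qed (use \<delta> in auto)
  have nz: "h z \<noteq> 0" if "z \<in> unit_disc" for z using disc[of z] that by auto
  have h0: "h 0 = 1" using ode[of 0] W0 \<zeta> by simp
  have re: "\<delta> < Re (1 + z * deriv h z / (of_real \<zeta> * h z))" if z: "z \<in> unit_disc" for z
  proof -
    \<comment> \<open>The differential equation divided by \<open>\<zeta> * h\<close>; a point
      within less than \<open>1 - \<delta>\<close> of 1 has real part above
      \<open>\<delta>\<close>.\<close>
    have eq: "1 + z * deriv h z / (of_real \<zeta> * h z) = exp (W z) / h z"
      using ode[of z] nz[OF z] z \<zeta> by (simp add: field_simps)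
    have "norm (exp (W z) / h z - 1) = norm (exp (W z) - h z) / norm (h z)"
      using nz[OF z] by (simp add: diff_divide_distrib flip: norm_divide)
    also have "\<dots> < 1 - \<delta>" using disc[of z] nz[OF z] z by (simp add: pos_divide_less_eq)
    finally show ?thesis
      unfolding eq using abs_Re_le_cmod[of "exp (W z) / h z - 1"] by simp
  qed
  have "operator_F n \<alpha> \<beta> lam \<zeta> = (\<lambda>z. z * powr_branch h (1 / \<zeta>) z)"
    by (simp add: operator_F_def h_def fun_eq_iff)
  then have "operator_F n \<alpha> \<beta> lam \<zeta> \<in> starlike_of_order \<delta>"
    using mult_exp_log_branch_starlike[OF \<zeta> \<delta>(2) hol h0 nz re] by simp
  then show ?thesis
    using \<delta> nz log_branch_exists[OF hol nz h0] by (auto simp: h_def)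
qed

end
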